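(* Let $X,Y$ be topological spaces such that $X$ or $Y$ is a sphere $S^m$ (for some $m\ge 0$), and let $f:X\to Y$ be a continuous map. Then $\mathrm{cat}(f)=2$ if and only if $f$ is not null-homotopic.
   Context: $S^m$ is the unit sphere in $\mathbb{R}^{m+1}$. A continuous map is null-homotopic if it is (freely) homotopic to a constant map. The category $\mathrm{cat}(f)$ of a continuous map $f:X\to Y$ is the least positive integer $n$ such that $X$ is a union of open subsets $U_1,\dots,U_n$ with each restriction $f_{|U_i}:U_i\to Y$ null-homotopic, and $\infty$ if no such integer exists. *)

theory Defs
  imports "HOL-Analysis.Analysis" "HOL-Library.Extended_Nat"
begin

(* topspace membership matters only if X is empty: then any c would do, even if Y has no points. *)
definition null_homotopic :: "'a topology \<Rightarrow> 'b topology \<Rightarrow> ('a \<Rightarrow> 'b) \<Rightarrow> bool" where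
  "null_homotopic X Y f \<longleftrightarrow>
     (\<exists>c \<in> topspace Y. homotopic_with (\<lambda>h. True) X Y f (\<lambda>x. c))"

definition null_homotopic_cover ::
    "'a topology \<Rightarrow> 'b topology \<Rightarrow> ('a \<Rightarrow> 'b) \<Rightarrow> nat \<Rightarrow> (nat \<Rightarrow> 'a set) \<Rightarrow> bool" where
  "null_homotopic_cover X Y f n U \<longleftrightarrow>
     (\<forall>i \<in> {1..n}. openin X (U i) \<and> null_homotopic (subtopology X (U i)) Y f) \<and>
     (\<Union>i \<in> {1..n}. U i) = topspace X"

definition map_cat :: "'a topology \<Rightarrow> 'b topology \<Rightarrow> ('a \<Rightarrow> 'b) \<Rightarrow> enat" where
  "map_cat X Y f =
     (if \<exists>n>0. \<exists>U. null_homotopic_cover X Y f n U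
      then enat (LEAST n. n > 0 \<and> (\<exists>U. null_homotopic_cover X Y f n U))
      else \<infinity>)"

end

theory Submission
  imports Defs
begin

text \<open>The complement of a point of a sphere deforms inside the sphere to the antipode, so the two
  complements of a pair of antipodes show that the identity of a sphere has category at most 2.
  Category does not grow under composition, and \<open>f\<close> factors through a sphere.\<close>

lemma null_homotopic_cong:
  assumes "null_homotopic X Y f" "\<And>x. x \<in> topspace X \<Longrightarrow> g x = f x"
  shows "null_homotopic X Y g"
proof -
  obtain c where "c \<in> topspace Y" "homotopic_with (\<lambda>h. True) X Y f (\<lambda>x. c)"
    using assms(1) unfolding null_homotopic_def by blast
  moreover from this(2) have "homotopic_with (\<lambda>h. True) X Y g (\<lambda>x. c)"
    by (rule homotopic_with_eq) (simp_all add: assms(2))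
  ultimately show ?thesis
    unfolding null_homotopic_def by blast
qed

lemma null_homotopic_compose_left:
  assumes "null_homotopic X Y f" "continuous_map Y Z g"
  shows "null_homotopic X Z (g \<circ> f)"
proof -
  obtain c where c: "c \<in> topspace Y" "homotopic_with (\<lambda>h. True) X Y f (\<lambda>x. c)"
    using assms(1) unfolding null_homotopic_def by blast
  have "homotopic_with (\<lambda>h. True) X Z (g \<circ> f) (g \<circ> (\<lambda>x. c))"
    using c(2) assms(2) by (rule homotopic_with_compose_continuous_map_left) simp
  moreover have "g c \<in> topspace Z"
    using assms(2) c(1) by (simp add: continuous_map_def Pi_iff)
  ultimately show ?thesis
    unfolding null_homotopic_def comp_def by blast
qed

lemma null_homotopic_compose_right:
  assumes "null_homotopic Y Z g" "continuous_map X Y f"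
  shows "null_homotopic X Z (g \<circ> f)"
proof -
  obtain c where c: "c \<in> topspace Z" "homotopic_with (\<lambda>h. True) Y Z g (\<lambda>x. c)"
    using assms(1) unfolding null_homotopic_def by blast
  have "homotopic_with (\<lambda>h. True) X Z (g \<circ> f) ((\<lambda>x. c) \<circ> f)"
    using c(2) assms(2) by (rule homotopic_with_compose_continuous_map_right) simp
  then show ?thesis
    using c(1) unfolding null_homotopic_def comp_def by blast
qed

text \<open>A factorisation of \<open>f\<close> through a sphere holds only on
  \<open>topspace X\<close>, while HOL functions are total. This transfers a cover between maps that
  agree on the space.\<close>

lemma null_homotopic_cover_cong:
  assumes "null_homotopic_cover X Y f n U" "\<And>x. x \<in> topspace X \<Longrightarrow> g x = f x"
  shows "null_homotopic_cover X Y g n U"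
  using assms unfolding null_homotopic_cover_def by (auto intro: null_homotopic_cong)

lemma null_homotopic_cover_compose_left:
  assumes "null_homotopic_cover X Y f n U" "continuous_map Y Z g"
  shows "null_homotopic_cover X Z (g \<circ> f) n U"
  using assms unfolding null_homotopic_cover_def by (auto intro: null_homotopic_compose_left)

text \<open>Pull the cover back: on the preimage of \<open>U i\<close> the map \<open>f\<close>
  lands in the subspace \<open>U i\<close>, where \<open>g\<close> already contracts.\<close>

lemma null_homotopic_cover_compose_right:
  assumes cover: "null_homotopic_cover Y Z g n U" and f: "continuous_map X Y f"
  shows "null_homotopic_cover X Z (g \<circ> f) n (\<lambda>i. {x \<in> topspace X. f x \<in> U i})"
proof -
  have "null_homotopic (subtopology X {x \<in> topspace X. f x \<in> U i}) Z (g \<circ> f)"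
    if "i \<in> {1..n}" for i
  proof (rule null_homotopic_compose_right)
    show "null_homotopic (subtopology Y (U i)) Z g"
      using cover that unfolding null_homotopic_cover_def by blast
    show "continuous_map (subtopology X {x \<in> topspace X. f x \<in> U i}) (subtopology Y (U i)) f"
      using f by (auto simp: continuous_map_in_subtopology continuous_map_from_subtopology)
  qed
  moreover have "openin X {x \<in> topspace X. f x \<in> U i}" if "i \<in> {1..n}" for i
    using cover that f openin_continuous_map_preimage unfolding null_homotopic_cover_def by blast
  moreover have "f x \<in> (\<Union>i\<in>{1..n}. U i)" if "x \<in> topspace X" for x
    using cover f that unfolding null_homotopic_cover_def by (simp add: continuous_map_def Pi_iff)
  ultimately show ?thesis
    unfolding null_homotopic_cover_def by blast
qed

lemma null_homotopic_cover_1_iff: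
  "(\<exists>U. null_homotopic_cover X Y f 1 U) \<longleftrightarrow> null_homotopic X Y f"
proof
  assume "null_homotopic X Y f"
  then have "null_homotopic_cover X Y f 1 (\<lambda>_. topspace X)"
    unfolding null_homotopic_cover_def by simp
  then show "\<exists>U. null_homotopic_cover X Y f 1 U" by blast
next
  assume "\<exists>U. null_homotopic_cover X Y f 1 U"
  then show "null_homotopic X Y f"
    unfolding null_homotopic_cover_def by auto
qed

text \<open>A cover of length 2 leaves only the values 1 and 2, since \<open>P\<close> asks for
  positive \<open>n\<close>, and length 1 means that \<open>f\<close> itself is
  null-homotopic.\<close>

lemma map_cat_eq_2_iff:
  assumes "null_homotopic_cover X Y f 2 U"
  shows "map_cat X Y f = 2 \<longleftrightarrow> \<not> null_homotopic X Y f"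
proof -
  define P where "P n \<longleftrightarrow> n > 0 \<and> (\<exists>U. null_homotopic_cover X Y f n U)" for n
  have P2: "P 2" and P1: "P 1 \<longleftrightarrow> null_homotopic X Y f"
    using assms unfolding P_def null_homotopic_cover_1_iff by auto
  have "map_cat X Y f = enat (LEAST n. P n)"
    using P2 by (auto simp: map_cat_def P_def[symmetric])
  then have "map_cat X Y f = 2 \<longleftrightarrow> (LEAST n. P n) = 2"
    by (simp add: numeral_eq_enat)
  also have "\<dots> \<longleftrightarrow> \<not> P 1"
  proof
    assume "(LEAST n. P n) = 2"
    then show "\<not> P 1"
      using Least_le[of P 1] by auto
  next
    assume *: "\<not> P 1"
    show "(LEAST n. P n) = 2"
    proof (rule Least_equality[of P, OF P2])
      fix n assume "P n"
      with * have "n \<noteq> 0" "n \<noteq> 1" by (auto simp: P_def)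
      then show "2 \<le> n" by simp
    qed
  qed
  finally show ?thesis using P1 by simp
qed

text \<open>Move \<open>x\<close> along the chord to the antipode \<open>p\<close> of the missing
  pole and project radially to the sphere. The chord could meet the origin only if \<open>x\<close>
  were the missing pole.\<close>

lemma null_homotopic_nsphere_minus_pole:
  fixes s :: real
  assumes s: "s = 1 \<or> s = -1"
  shows "null_homotopic (subtopology (nsphere m) {x. x 0 \<noteq> s}) (nsphere m) id"
proof -
  let ?X = "subtopology (nsphere m) {x. x 0 \<noteq> s}"
  let ?P = "prod_topology (top_of_set {0..1::real}) ?X"
  define p :: "nat \<Rightarrow> real" where "p = (\<lambda>i. if i = 0 then - s else 0)"
  \<comment> \<open>\<open>N\<close> is the squared norm of the point \<open>(1 - t) x + t p\<close> of the chord.\<close>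
  define N :: "real \<times> (nat \<Rightarrow> real) \<Rightarrow> real"
    where "N = (\<lambda>z. 1 - 2 * fst z * (1 - fst z) * (1 + s * snd z 0))"
  define h :: "real \<times> (nat \<Rightarrow> real) \<Rightarrow> nat \<Rightarrow> real"
    where "h = (\<lambda>z i. ((1 - fst z) * snd z i + fst z * p i) / sqrt (N z))"
  have ss: "s * s = 1" using s by auto
  have p: "p \<in> topspace (nsphere m)"
  proof -
    have "(\<Sum>i\<le>m. (p i)\<^sup>2) = (\<Sum>i\<le>m. if i = 0 then 1 else 0)"
      by (rule sum.cong) (auto simp: p_def power2_eq_square ss)
    then show ?thesis
      by (simp add: nsphere p_def)
  qed
  have sphere: "(\<Sum>i\<le>m. (x i)\<^sup>2) = 1" "\<And>i. i > m \<Longrightarrow> x i = 0" "x 0 \<noteq> s"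
    if "x \<in> topspace ?X" for x
    using that by (auto simp: nsphere)
  have N_pos: "N (t, x) > 0" if t: "t \<in> {0..1}" and x: "x \<in> topspace ?X" for t x
  proof -
    have "(x 0)\<^sup>2 \<le> (\<Sum>i\<le>m. (x i)\<^sup>2)"
      by (rule member_le_sum) auto
    then have "\<bar>x 0\<bar> \<le> 1"
      using sphere(1)[OF x] by (simp add: abs_square_le_1)
    then have sx: "s * x 0 < 1" "0 \<le> 1 + s * x 0"
      using s sphere(3)[OF x] by auto
    \<comment> \<open>The worst case is the midpoint of the chord, which gives
      \<open>N (t, x) \<ge> (1 - s * x 0) / 2\<close>; this is positive away from the pole.\<close>
    have "2 * t * (1 - t) \<le> 1/2"
      using zero_le_power2[of "2 * t - 1"] by (simp add: power2_eq_square algebra_simps)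
    then have "2 * t * (1 - t) * (1 + s * x 0) \<le> 1/2 * (1 + s * x 0)"
      using sx(2) by (rule mult_right_mono)
    then show ?thesis
      using sx(1) unfolding N_def by simp
  qed
  have N_eq: "(\<Sum>i\<le>m. ((1 - t) * x i + t * p i)\<^sup>2) = N (t, x)" if x: "x \<in> topspace ?X" for t x
  proof -
    \<comment> \<open>Only coordinate 0 of \<open>p\<close> is nonzero, so the cross terms of the
      squares reduce to the single one at \<open>i = 0\<close>.\<close>
    have "(\<Sum>i\<le>m. ((1 - t) * x i + t * p i)\<^sup>2)
        = (\<Sum>i\<le>m. (1 - t)\<^sup>2 * (x i)\<^sup>2 + t\<^sup>2 * (p i)\<^sup>2
            + (if i = 0 then - 2 * t * (1 - t) * s * x 0 else 0))"
      by (rule sum.cong) (auto simp: p_def power2_eq_square algebra_simps)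
    also have "\<dots> = (1 - t)\<^sup>2 * (\<Sum>i\<le>m. (x i)\<^sup>2) + t\<^sup>2 * (\<Sum>i\<le>m. (p i)\<^sup>2)
            - 2 * t * (1 - t) * s * x 0"
      by (simp add: sum.distrib sum_distrib_left)
    also have "\<dots> = (1 - t)\<^sup>2 + t\<^sup>2 - 2 * t * (1 - t) * s * x 0"
      using sphere(1)[OF x] p by (simp add: nsphere)
    also have "\<dots> = N (t, x)"
      by (simp add: N_def power2_eq_square algebra_simps)
    finally show ?thesis .
  qed
  have fst_cont: "continuous_map ?P euclideanreal fst"
    using continuous_map_fst continuous_map_into_fulltopology by blast
  have snd_cont: "continuous_map ?P euclideanreal (\<lambda>z. snd z i)" for i
  proof -
    have "continuous_map ?X euclideanreal (\<lambda>x. x i)"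
      by (rule continuous_map_from_subtopology[OF continuous_map_nsphere_projection])
    from continuous_map_compose[OF continuous_map_snd this] show ?thesis
      by (simp add: o_def)
  qed
  have N_cont: "continuous_map ?P euclideanreal N"
    unfolding N_def by (intro continuous_intros fst_cont snd_cont)
  \<comment> \<open>With the sphere written as a subspace of a product, continuity splits into
    continuity of each coordinate and membership of the values.\<close>
  have "continuous_map ?P (subtopology (powertop_real UNIV)
      {x. (\<Sum>i\<le>m. (x i)\<^sup>2) = 1 \<and> (\<forall>i>m. x i = 0)}) h"
    unfolding continuous_map_in_subtopology continuous_map_componentwise_UNIV
  proof (intro conjI allI funcsetI)
    fix i
    show "continuous_map ?P euclideanreal (\<lambda>z. h z i)"
      unfolding h_def
    proof (intro continuous_map_real_divide continuous_map_sqrt N_cont)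
      show "continuous_map ?P euclideanreal (\<lambda>z. (1 - fst z) * snd z i + fst z * p i)"
        by (intro continuous_intros fst_cont snd_cont)
      show "sqrt (N z) \<noteq> 0" if "z \<in> topspace ?P" for z
        using that N_pos[of "fst z" "snd z"] by auto
    qed
  next
    fix z assume "z \<in> topspace ?P"
    then obtain t x where z: "z = (t, x)" and t: "t \<in> {0..1}" and x: "x \<in> topspace ?X"
      by auto
    have "(\<Sum>i\<le>m. (h z i)\<^sup>2) = (\<Sum>i\<le>m. ((1 - t) * x i + t * p i)\<^sup>2) / N z"
      using N_pos[OF t x] by (simp add: h_def z power_divide sum_divide_distrib)
    also have "\<dots> = 1"
      using N_eq[OF x] N_pos[OF t x] z by simp
    finally have "(\<Sum>i\<le>m. (h z i)\<^sup>2) = 1" .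
    moreover have "h z i = 0" if "i > m" for i
      using sphere(2)[OF x that] that by (simp add: h_def z p_def)
    ultimately show "h z \<in> {x. (\<Sum>i\<le>m. (x i)\<^sup>2) = 1 \<and> (\<forall>i>m. x i = 0)}"
      by blast
  qed
  then have "continuous_map ?P (nsphere m) h"
    by (simp only: nsphere)
  \<comment> \<open>\<open>homotopic_with_def\<close> wants the end conditions for every
    \<open>x\<close>, also off the sphere. They hold there because the closed formula for
    \<open>N\<close> gives 1 at \<open>t = 0\<close> and \<open>t = 1\<close> whatever
    \<open>x\<close> is.\<close>
  moreover have "h (0, x) = id x" "h (1, x) = p" for x
    by (simp_all add: h_def N_def fun_eq_iff)
  ultimately show ?thesis
    unfolding null_homotopic_def homotopic_with_def using p by blast
qed

lemma nsphere_null_homotopic_cover: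
  "\<exists>U. null_homotopic_cover (nsphere m) (nsphere m) id 2 U"
proof -
  define s :: "nat \<Rightarrow> real" where "s i = (if i = 1 then 1 else -1)" for i
  \<comment> \<open>Written as the preimage of an open set under the coordinate 0, so that openness
    is immediate. The two sets cover because \<open>x 0\<close> cannot be both 1 and -1; this
    includes \<open>m = 0\<close>, where each set is one point.\<close>
  define U where "U i = {x \<in> topspace (nsphere m). x 0 \<in> - {s i}}" for i
  have "openin (nsphere m) (U i)" for i
    unfolding U_def
    by (rule openin_continuous_map_preimage[OF continuous_map_nsphere_projection]) (simp add: open_Compl)
  moreover have "null_homotopic (subtopology (nsphere m) (U i)) (nsphere m) id" for i
  proof -
    have "subtopology (nsphere m) (U i) = subtopology (nsphere m) {x. x 0 \<noteq> s i}"
      using subtopology_restrict[of "nsphere m" "{x. x 0 \<noteq> s i}"] by (simp add: U_def Collect_conj_eq)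
    then show ?thesis
      using null_homotopic_nsphere_minus_pole[of "s i" m] by (simp add: s_def)
  qed
  moreover have "(\<Union>i\<in>{1..2}. U i) = topspace (nsphere m)"
  proof -
    have "{1..2::nat} = {1, 2}" by auto
    then show ?thesis by (auto simp: U_def s_def)
  qed
  ultimately show ?thesis
    unfolding null_homotopic_cover_def by blast
qed

text \<open>Common form of the two cases of the theorem: the cover of the sphere by punctured
  spheres is kept under composition with \<open>k\<close> and then pulled back along
  \<open>h\<close>.\<close>

lemma null_homotopic_cover_factor_nsphere:
  assumes "continuous_map X (nsphere m) h" "continuous_map (nsphere m) Y k"
    and "\<And>x. x \<in> topspace X \<Longrightarrow> f x = k (h x)"
  shows "\<exists>U. null_homotopic_cover X Y f 2 U"
proof -
  obtain U where "null_homotopic_cover (nsphere m) (nsphere m) id 2 U"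
    using nsphere_null_homotopic_cover by blast
  then have "null_homotopic_cover (nsphere m) Y (k \<circ> id) 2 U"
    using assms(2) by (rule null_homotopic_cover_compose_left)
  then have "null_homotopic_cover X Y (k \<circ> id \<circ> h) 2 (\<lambda>i. {x \<in> topspace X. h x \<in> U i})"
    using assms(1) by (rule null_homotopic_cover_compose_right)
  then have "null_homotopic_cover X Y f 2 (\<lambda>i. {x \<in> topspace X. h x \<in> U i})"
    by (rule null_homotopic_cover_cong) (simp add: assms(3))
  then show ?thesis by blast
qed

theorem mainTheorem13:
  fixes X :: "'a topology" and Y :: "'b topology" and f :: "'a \<Rightarrow> 'b"
  assumes "(\<exists>m. X homeomorphic_space nsphere m) \<or> (\<exists>m. Y homeomorphic_space nsphere m)"
    and "continuous_map X Y f"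
  shows "map_cat X Y f = 2 \<longleftrightarrow> \<not> null_homotopic X Y f"
proof -
  have "\<exists>U. null_homotopic_cover X Y f 2 U"
    using assms(1)
  proof (elim disjE exE)
    fix m assume "X homeomorphic_space nsphere m"
    then obtain h g where "homeomorphic_maps X (nsphere m) h g"
      unfolding homeomorphic_space_def by blast
    then have hg: "continuous_map X (nsphere m) h" "continuous_map (nsphere m) X g"
      "\<And>x. x \<in> topspace X \<Longrightarrow> g (h x) = x"
      unfolding homeomorphic_maps_def by auto
    \<comment> \<open>Here the sphere is the source: factor \<open>f\<close> as
      \<open>f \<circ> g\<close> after the homeomorphism \<open>h\<close>.\<close>
    show ?thesis
      by (rule null_homotopic_cover_factor_nsphere[OF hg(1) continuous_map_compose[OF hg(2) assms(2)]])
         (simp add: hg(3))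
  next
    fix m assume "Y homeomorphic_space nsphere m"
    then obtain h g where "homeomorphic_maps Y (nsphere m) h g"
      unfolding homeomorphic_space_def by blast
    then have hg: "continuous_map Y (nsphere m) h" "continuous_map (nsphere m) Y g"
      "\<And>y. y \<in> topspace Y \<Longrightarrow> g (h y) = y"
      unfolding homeomorphic_maps_def by auto
    \<comment> \<open>Here the sphere is the target: \<open>f\<close> is \<open>g\<close> after
      \<open>h \<circ> f\<close>. The inverse law \<open>g (h y) = y\<close> is known only on
      \<open>topspace Y\<close>, hence this check.\<close>
    have "f x \<in> topspace Y" if "x \<in> topspace X" for x
      using assms(2) that by (simp add: continuous_map_def Pi_iff)
    then show ?thesis
      by (intro null_homotopic_cover_factor_nsphere[OF continuous_map_compose[OF assms(2) hg(1)] hg(2)])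
         (simp add: hg(3))
  qed
  then show ?thesis
    using map_cat_eq_2_iff by blast
qed

end
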